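(* Assume that (a) the set $A(x)$ is compact for every $x\in X$; (b) $c:\mathbb K\to\mathbb R$ is lower semicontinuous, nonnegative and inf-compact on $\mathbb K$; (c) $Q$ is strongly Feller; and (d) there exist $\bar c>0$, $\beta\in[1,1/\alpha)$ and a measurable weight function $w:X\setminus K\to[1,\infty)$ such that for every $x\in X\setminus K$ $$\sup_{a\in A(x)}c(x,a)\le\bar c\,w(x)\qquad\text{and}\qquad\sup_{a\in A(x)}\int_{X\setminus K}Q(\mathrm dy\mid x,a)\,w(y)\le\beta\,w(x).$$ Let $\gamma:=\alpha\beta$. For every $N\in\{0,1,2,\ldots\}$ and $x\in X\setminus K$, the rolling-horizon policy $\hat f_N^\infty$ satisfies $$0\le V(\hat f_N^\infty,x)-v_{N+1}(x)\le\bar c\,w(x)\left(\frac{\gamma^{N+1}}{1-\gamma}\right).$$ In particular, $$V(\hat f_N^\infty,x)-V^\star(x)\le\bar c\,w(x)\left(\frac{\gamma^{N+1}}{1-\gamma}\right).$$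
   Context: Control model. $X$ (state space) and $A$ (action set) are nonempty Borel subsets of Polish spaces. For each $x\in X$, $A(x)\subseteq A$ is a nonempty measurable set of feasible actions; the set $\{(x,a): x\in X,\ a\in A(x)\}$ is a measurable subset of $X\times A$ and contains the graph of a measurable function from $X$ to $A$. $Q$ is a stochastic kernel on $X$ given the feasible state-action pairs (the transition law). $K\subseteq X$ is a measurable target set (not assumed absorbing), $\mathbb K:=\{(x,a)\in X\times A: x\in X\setminus K,\ a\in A(x)\}$, and $c:\mathbb K\to\mathbb R$ is a measurable cost-per-stage function. $\alpha\in(0,1)$ is fixed. "Measurable" means Borel-measurable. $\mathbb F$ is the set of selectors, i.e. measurable $f:X\setminus K\to A$ with $f(x)\in A(x)$ for all $x\in X\setminus K$; one writes $c(x,f):=c(x,f(x))$ and $Q(\cdot\mid x,f):=Q(\cdot\mid x,f(x))$. Policies and process. $\tau:=\inf\{i\ge 0: x_i\in K\}$ (with $\inf\emptyset=+\infty$). The process is controlled only up to $\tau$: a policy $\pi=(\varphi_t)_{t\ge0}$ in the class $\Pi$ (randomized Markov policies) is a sequence of stochastic kernels $\varphi_t$ on $A$ with $\varphi_t(A(x)\mid x)=1$ for $x\in X\setminus K$. Under $\mathsf P^\pi_x$ one has $x_0=x$ and, on $\{t<\tau\}$, conditionally on the history up to time $t$, $a_t\sim\varphi_t(\cdot\mid x_t)$ and then $x_{t+1}\sim Q(\cdot\mid x_t,a_t)$. For $f\in\mathbb F$, $f^\infty$ denotes the deterministic stationary policy with $a_t=f(x_t)$ for all $t<\tau$. Costs.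 $V(\pi,x):=\mathsf E^\pi_x\big[\sum_{i=0}^{\tau-1}\alpha^i c(x_i,a_i)\big]$ and $V^\star(x):=\inf_{\pi\in\Pi}V(\pi,x)$, $x\in X\setminus K$. The $\alpha$-value iteration functions are $v_0:=0$ and, for $n\ge1$ and $x\in X\setminus K$, $v_n(x):=\min_{a\in A(x)}\big[c(x,a)+\alpha\int_{X\setminus K}Q(\mathrm dy\mid x,a)\,v_{n-1}(y)\big]$. Rolling-horizon policy. For horizon $N$, consider the $(N+1)$-period stopped problem of minimizing $\mathsf E^\pi_x\big[\sum_{i=0}^{N\wedge(\tau-1)}\alpha^i c(x_i,a_i)\big]$, whose optimal value is $v_{N+1}(x)$ and whose optimal policy is realized by selectors $(\hat f_N,\hat f_{N-1},\ldots,\hat f_0)$, used in this order. Thus $\hat f_N\in\mathbb F$ is the first-stage selector, i.e. a selector attaining the minimum in the definition of $v_{N+1}$: $v_{N+1}(x)=c(x,\hat f_N)+\alpha\int_{X\setminus K}Q(\mathrm dy\mid x,\hat f_N)\,v_N(y)$ for all $x\in X\setminus K$. The rolling-horizon procedure re-solves this problem at each time and applies the first-stage selector, so the rolling-horizon policy is the deterministic stationary policy $\hat f_N^\infty=(\hat f_N,\hat f_N,\ldots)$. Regularity notions. A function $g:\mathbb K\to\mathbb R$ is lower semicontinuous if $\liminf_j g(x_j,a_j)\ge g(x,a)$ whenever $(x_j,a_j)\to(x,a)$ in $\mathbb K$; it is inf-compact on $\mathbb K$ if for every $x\in X\setminus K$ and $r\in\mathbb R$ the set $\{a\in A(x): g(x,a)\le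 r\}$ is compact. $Q$ is strongly Feller if for every bounded measurable $g:X\to\mathbb R$ the map $(x,a)\mapsto\int_X g(y)\,Q(\mathrm dy\mid x,a)$ is continuous and bounded on $\mathbb K$. *)

theory Defs
  imports "HOL-Probability.Probability"
begin

text \<open>
  A control model on Borel subsets of Polish spaces. The cost, a function on the feasible pairs
  outside the target set, is totalised to all pairs, and so is the transition law; values outside
  the intended domains are never used.
\<close>

record ('x, 'a) control_model =
  states :: "'x set"
  actions :: "'a set"
  feasible :: "'x \<Rightarrow> 'a set"
  trans_law :: "'x \<times> 'a \<Rightarrow> 'x measure"
  target :: "'x set"
  cost :: "'x \<times> 'a \<Rightarrow> real"
  discount :: real

definition state_space :: "('x::topological_space, 'a) control_model \<Rightarrow> 'x measure" where
  "state_space M = restrict_space borel (states M)"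

definition action_space :: "('x, 'a::topological_space) control_model \<Rightarrow> 'a measure" where
  "action_space M = restrict_space borel (actions M)"

definition live :: "('x, 'a) control_model \<Rightarrow> 'x set" where
  "live M = states M - target M"

definition feasible_graph :: "('x, 'a) control_model \<Rightarrow> ('x \<times> 'a) set" where
  "feasible_graph M = {(x, a). x \<in> states M \<and> a \<in> feasible M x}"

definition live_graph :: "('x, 'a) control_model \<Rightarrow> ('x \<times> 'a) set" where
  "live_graph M = {(x, a). x \<in> live M \<and> a \<in> feasible M x}"

definition is_control_model :: "('x::polish_space, 'a::polish_space) control_model \<Rightarrow> bool" where
  "is_control_model M \<longleftrightarrow>
     states M \<in> sets borel \<and> states M \<noteq> {} \<and>
     actions M \<in> sets borel \<and> actions M \<noteq> {} \<and>
     (\<forall>x\<in>states M. feasible M x \<in> sets borel \<and> feasible M x \<noteq> {} \<and> feasible M x \<subseteq> actions M) \<and>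
     feasible_graph M \<in> sets borel \<and>
     (\<exists>f \<in> state_space M \<rightarrow>\<^sub>M action_space M. \<forall>x\<in>states M. f x \<in> feasible M x) \<and>
     trans_law M \<in> restrict_space borel (feasible_graph M) \<rightarrow>\<^sub>M prob_algebra (state_space M) \<and>
     target M \<in> sets borel \<and> target M \<subseteq> states M \<and>
     cost M \<in> borel_measurable (restrict_space borel (live_graph M)) \<and>
     0 < discount M \<and> discount M < 1"

definition selectors :: "('x::topological_space, 'a::topological_space) control_model \<Rightarrow> ('x \<Rightarrow> 'a) set" where
  "selectors M = {f. f \<in> restrict_space borel (live M) \<rightarrow>\<^sub>M action_space M \<and>
                     (\<forall>x\<in>live M. f x \<in> feasible M x)}"

text \<open>
  Randomized Markov policies. As the process is controlled only up to the hitting time of the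
  target, the decision kernels matter on the live states only.
\<close>

definition policies ::
  "('x::topological_space, 'a::topological_space) control_model \<Rightarrow> (nat \<Rightarrow> 'x \<Rightarrow> 'a measure) set" where
  "policies M = {\<pi>. \<forall>t. \<pi> t \<in> restrict_space borel (live M) \<rightarrow>\<^sub>M prob_algebra (action_space M) \<and>
                        (\<forall>x\<in>live M. emeasure (\<pi> t x) (feasible M x) = 1)}"

definition stationary ::
  "('x, 'a::topological_space) control_model \<Rightarrow> ('x \<Rightarrow> 'a) \<Rightarrow> nat \<Rightarrow> 'x \<Rightarrow> 'a measure" where
  "stationary M f = (\<lambda>t x. return (action_space M) (f x))"

text \<open>
  The law of the controlled process is built by the Ionescu-Tulcea theorem on sequences of
  state-action pairs. The continuation after the hitting time is immaterial; to have total kernels,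
  the state is frozen at the target state that was hit and a fixed dummy action is taken there.
  The state is likewise frozen at live states with an infeasible action, an event of
  probability zero.
\<close>

definition decision_law ::
  "('x, 'a::topological_space) control_model \<Rightarrow> ('x \<Rightarrow> 'a measure) \<Rightarrow> 'x \<Rightarrow> 'a measure" where
  "decision_law M \<phi> x =
     (if x \<in> live M then \<phi> x else return (action_space M) (SOME a. a \<in> actions M))"

definition next_state_law ::
  "('x::topological_space, 'a) control_model \<Rightarrow> 'x \<times> 'a \<Rightarrow> 'x measure" where
  "next_state_law M z = (if z \<in> live_graph M then trans_law M z else return (state_space M) (fst z))"

definition pair_space ::
  "('x::topological_space, 'a::topological_space) control_model \<Rightarrow> ('x \<times> 'a) measure" where
  "pair_space M = state_space M \<Otimes>\<^sub>M action_space M"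

definition pair_law ::
  "('x::topological_space, 'a::topological_space) control_model \<Rightarrow> ('x \<Rightarrow> 'a measure) \<Rightarrow>
   'x measure \<Rightarrow> ('x \<times> 'a) measure" where
  "pair_law M \<phi> \<nu> =
     \<nu> \<bind> (\<lambda>x. decision_law M \<phi> x \<bind> (\<lambda>a. return (pair_space M) (x, a)))"

primrec step_law ::
  "('x::topological_space, 'a::topological_space) control_model \<Rightarrow> (nat \<Rightarrow> 'x \<Rightarrow> 'a measure) \<Rightarrow> 'x \<Rightarrow>
   nat \<Rightarrow> (nat \<Rightarrow> 'x \<times> 'a) \<Rightarrow> ('x \<times> 'a) measure" where
  "step_law M \<pi> x 0 = (\<lambda>\<omega>. pair_law M (\<pi> 0) (return (state_space M) x))"
| "step_law M \<pi> x (Suc t) = (\<lambda>\<omega>. pair_law M (\<pi> (Suc t)) (next_state_law M (\<omega> t)))"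

definition process_law ::
  "('x::topological_space, 'a::topological_space) control_model \<Rightarrow> (nat \<Rightarrow> 'x \<Rightarrow> 'a measure) \<Rightarrow> 'x \<Rightarrow>
   (nat \<Rightarrow> 'x \<times> 'a) measure" where
  "process_law M \<pi> x =
     projective_family.lim UNIV
       (Ionescu_Tulcea.CI (step_law M \<pi> x) (\<lambda>_. pair_space M)) (\<lambda>_. pair_space M)"

definition hitting_time :: "('x, 'a) control_model \<Rightarrow> (nat \<Rightarrow> 'x \<times> 'a) \<Rightarrow> enat" where
  "hitting_time M \<omega> = Inf {enat i | i. fst (\<omega> i) \<in> target M}"

text \<open>
  The costs below are meant for models with nonnegative cost, so expected costs always exist in
  \<open>[0, \<infinity>]\<close>; they are therefore \<open>ennreal\<close>-valued, and the conversion by \<open>ennreal\<close> loses nothing.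
\<close>

definition policy_cost ::
  "('x::topological_space, 'a::topological_space) control_model \<Rightarrow> (nat \<Rightarrow> 'x \<Rightarrow> 'a measure) \<Rightarrow> 'x \<Rightarrow>
   ennreal" where
  "policy_cost M \<pi> x =
     (\<integral>\<^sup>+\<omega>. (\<Sum>i. if enat i < hitting_time M \<omega> then ennreal (discount M ^ i * cost M (\<omega> i)) else 0)
        \<partial>process_law M \<pi> x)"

definition optimal_cost ::
  "('x::topological_space, 'a::topological_space) control_model \<Rightarrow> 'x \<Rightarrow> ennreal" where
  "optimal_cost M x = (INF \<pi>\<in>policies M. policy_cost M \<pi> x)"

text \<open>
  The minimum over the feasible actions is written as an infimum; it being attained is part of
  \<open>first_stage_selector\<close>.
\<close>

primrec value_iter :: "('x, 'a) control_model \<Rightarrow> nat \<Rightarrow> 'x \<Rightarrow> ennreal" where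
  "value_iter M 0 = (\<lambda>x. 0)"
| "value_iter M (Suc n) =
     (\<lambda>x. INF a\<in>feasible M x. ennreal (cost M (x, a)) +
        ennreal (discount M) * (\<integral>\<^sup>+y\<in>live M. value_iter M n y \<partial>trans_law M (x, a)))"

definition first_stage_selector ::
  "('x::topological_space, 'a::topological_space) control_model \<Rightarrow> nat \<Rightarrow> ('x \<Rightarrow> 'a) \<Rightarrow> bool" where
  "first_stage_selector M N f \<longleftrightarrow>
     f \<in> selectors M \<and>
     (\<forall>x\<in>live M. value_iter M (Suc N) x = ennreal (cost M (x, f x)) +
        ennreal (discount M) * (\<integral>\<^sup>+y\<in>live M. value_iter M N y \<partial>trans_law M (x, f x)))"

definition lsc_on :: "'z::topological_space set \<Rightarrow> ('z \<Rightarrow> real) \<Rightarrow> bool" where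
  "lsc_on S g \<longleftrightarrow>
     (\<forall>z. \<forall>l\<in>S. (\<forall>j. z j \<in> S) \<and> z \<longlonglongrightarrow> l \<longrightarrow> ereal (g l) \<le> liminf (\<lambda>j. ereal (g (z j))))"

definition inf_compact ::
  "('x, 'a::topological_space) control_model \<Rightarrow> ('x \<times> 'a \<Rightarrow> real) \<Rightarrow> bool" where
  "inf_compact M g \<longleftrightarrow> (\<forall>x\<in>live M. \<forall>r. compact {a \<in> feasible M x. g (x, a) \<le> r})"

definition strongly_feller :: "('x::topological_space, 'a::topological_space) control_model \<Rightarrow> bool" where
  "strongly_feller M \<longleftrightarrow>
     (\<forall>g :: 'x \<Rightarrow> real. g \<in> borel_measurable (state_space M) \<and> bounded (g ` states M) \<longrightarrow>
        continuous_on (live_graph M) (\<lambda>z. \<integral>y. g y \<partial>trans_law M z) \<and>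
        bounded ((\<lambda>z. \<integral>y. g y \<partial>trans_law M z) ` live_graph M))"

text \<open>
  The step kernels satisfy the hypotheses of the Ionescu-Tulcea theorem, so \<open>process_law\<close> is the
  probability measure it is meant to be.
\<close>

lemma live_graph_in: fixes M :: "('x::polish_space, 'a::polish_space) control_model"
  assumes "is_control_model M"
  shows "live_graph M \<in> sets (pair_space M)"
proof -
  have X: "states M \<in> sets borel" "actions M \<in> sets borel" "target M \<in> sets borel"
    and G: "feasible_graph M \<in> sets borel"
    and F: "\<And>x. x \<in> states M \<Longrightarrow> feasible M x \<subseteq> actions M"
    using assms by (auto simp: is_control_model_def)
  have eq: "live_graph M = feasible_graph M \<inter> (live M \<times> UNIV)"
    by (auto simp: live_graph_def feasible_graph_def live_def)
  have "live M \<in> sets borel" using X by (auto simp: live_def)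
  then have "live M \<times> (UNIV::'a set) \<in> sets (borel \<Otimes>\<^sub>M borel)" by (intro pair_measureI) auto
  then have L: "live_graph M \<in> sets (borel \<Otimes>\<^sub>M borel)"
    using G unfolding eq borel_prod by auto
  have "(\<lambda>z. (fst z, snd z)) \<in> pair_space M \<rightarrow>\<^sub>M borel \<Otimes>\<^sub>M borel"
    unfolding pair_space_def state_space_def action_space_def
    by (intro measurable_Pair measurable_fst'' measurable_snd'' measurable_restrict_space1) simp_all
  then have "(\<lambda>z. z) \<in> pair_space M \<rightarrow>\<^sub>M borel \<Otimes>\<^sub>M borel" by simp
  from measurable_sets[OF this L]
  have "live_graph M \<inter> space (pair_space M) \<in> sets (pair_space M)" by simp
  moreover have "live_graph M \<subseteq> space (pair_space M)"
    using F by (auto simp: pair_space_def space_pair_measure state_space_def action_space_def space_restrict_space live_graph_def live_def)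
  ultimately show ?thesis by (simp add: Int_absorb2)
qed

lemma decision_meas: fixes M :: "('x::polish_space, 'a::polish_space) control_model"
  assumes "is_control_model M" "\<pi> \<in> policies M"
  shows "decision_law M (\<pi> t) \<in> state_space M \<rightarrow>\<^sub>M prob_algebra (action_space M)"
proof -
  have X: "states M \<in> sets borel" "actions M \<in> sets borel" "target M \<in> sets borel" "actions M \<noteq> {}"
    using assms by (auto simp: is_control_model_def)
  have "(SOME a. a \<in> actions M) \<in> space (action_space M)"
    using X(4) by (auto simp: action_space_def space_restrict_space some_in_eq)
  moreover have "restrict_space (state_space M) (live M) = restrict_space borel (live M)"
    using X by (auto simp: state_space_def restrict_restrict_space live_def intro!: arg_cong2[where f = restrict_space])
  moreover have "{x \<in> space (state_space M). x \<in> live M} \<in> sets (state_space M)"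
    using X by (auto simp: Collect_conj_eq state_space_def space_restrict_space sets_restrict_space live_def)
  ultimately show ?thesis unfolding decision_law_def
    using assms(2)
    by (subst measurable_If_restrict_space_iff) (auto simp: policies_def space_prob_algebra prob_space_return  intro!: measurable_const)
qed

lemma next_meas: fixes M :: "('x::polish_space, 'a::polish_space) control_model"
  assumes "is_control_model M"
  shows "next_state_law M \<in> pair_space M \<rightarrow>\<^sub>M prob_algebra (state_space M)"
proof -
  have L: "live_graph M \<in> sets (pair_space M)" by (rule live_graph_in[OF assms])
  have T: "trans_law M \<in> restrict_space borel (feasible_graph M) \<rightarrow>\<^sub>M prob_algebra (state_space M)"
    using assms by (simp add: is_control_model_def)
  have "(\<lambda>z. (fst z, snd z)) \<in> pair_space M \<rightarrow>\<^sub>M borel \<Otimes>\<^sub>M borel"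
    unfolding pair_space_def state_space_def action_space_def
    by (intro measurable_Pair measurable_fst'' measurable_snd'' measurable_restrict_space1) simp_all
  then have "(\<lambda>z. z) \<in> pair_space M \<rightarrow>\<^sub>M borel" by (simp add: borel_prod)
  then have "(\<lambda>z. z) \<in> restrict_space (pair_space M) (live_graph M) \<rightarrow>\<^sub>M restrict_space borel (feasible_graph M)"
    by (intro measurable_restrict_space2 measurable_restrict_space1)
       (auto simp: space_restrict_space live_graph_def feasible_graph_def live_def)
  from measurable_compose[OF this T]
  have 1: "trans_law M \<in> restrict_space (pair_space M) (live_graph M) \<rightarrow>\<^sub>M prob_algebra (state_space M)" .
  have 2: "(\<lambda>z. return (state_space M) (fst z)) \<in> pair_space M \<rightarrow>\<^sub>M prob_algebra (state_space M)"
    unfolding pair_space_def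
    by (rule measurable_compose[OF measurable_fst measurable_return_prob_space])
  show ?thesis unfolding next_state_law_def
    using L 1 2 sets.sets_into_space[OF L]
    by (subst measurable_If_restrict_space_iff) (auto intro!: measurable_restrict_space1 simp: Int_absorb2)
qed

lemma pair_law_meas: fixes M :: "('x::polish_space, 'a::polish_space) control_model"
  assumes "is_control_model M" "\<pi> \<in> policies M" "g \<in> N \<rightarrow>\<^sub>M prob_algebra (state_space M)"
  shows "(\<lambda>z. pair_law M (\<pi> t) (g z)) \<in> N \<rightarrow>\<^sub>M prob_algebra (pair_space M)"
proof -
  note [measurable] = decision_meas[OF assms(1,2)] assms(3)
  show ?thesis unfolding pair_law_def pair_space_def
    by (rule measurable_bind_prob_space2[OF assms(3)]) measurable
qed

lemma Ionescu_Tulcea_step_law: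
  fixes M :: "('x::polish_space, 'a::polish_space) control_model"
  assumes "is_control_model M" "\<pi> \<in> policies M" "x \<in> states M"
  shows "Ionescu_Tulcea (step_law M \<pi> x) (\<lambda>_. pair_space M)"
proof -
  have *: "step_law M \<pi> x i \<in> PiM {0..<i} (\<lambda>_. pair_space M) \<rightarrow>\<^sub>M prob_algebra (pair_space M)" for i
  proof (cases i)
    case 0
    show ?thesis unfolding 0 step_law.simps
      by (rule pair_law_meas[OF assms(1,2)]) (auto simp: space_prob_algebra state_space_def space_restrict_space assms(3) intro!: prob_space_return)
  next
    case (Suc j)
    have "(\<lambda>\<omega>. \<omega> j) \<in> PiM {0..<Suc j} (\<lambda>_. pair_space M) \<rightarrow>\<^sub>M pair_space M"
      by (rule measurable_component_singleton) simp
    from measurable_compose[OF this next_meas[OF assms(1)]] show ?thesis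
      unfolding Suc step_law.simps by (rule pair_law_meas[OF assms(1,2)])
  qed
  show ?thesis
    using measurable_space[OF *]
    by (intro Ionescu_Tulcea.intro measurable_prob_algebraD[OF *]) (auto simp: space_prob_algebra)
qed

lemma stationary_in_policies:
  fixes M :: "('x::polish_space, 'a::polish_space) control_model"
  assumes "is_control_model M" "f \<in> selectors M"
  shows "stationary M f \<in> policies M"
proof -
  have f: "f \<in> restrict_space borel (live M) \<rightarrow>\<^sub>M action_space M" "\<forall>x\<in>live M. f x \<in> feasible M x"
    using assms(2) by (auto simp: selectors_def)
  have "feasible M x \<in> sets (action_space M)" if "x \<in> live M" for x
    using assms(1) that
    by (auto simp: is_control_model_def live_def action_space_def sets_restrict_space_iff)
  then show ?thesis
    using f measurable_compose[OF f(1) measurable_return_prob_space]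
    by (auto simp: policies_def stationary_def)
qed

end

theory Submission
  imports Defs
begin

text \<open>
  Write \<open>v n\<close> for value iteration, \<open>f\<close> for a first-stage selector of horizon \<open>N\<close>, and
  \<open>T g = c(\<cdot>, f) + \<alpha> \<integral> g dQ(\<cdot> | \<cdot>, f)\<close>, the integral being over the live states,
  and \<open>\<gamma> = \<alpha> \<beta>\<close>. The argument is a comparison of finite-horizon costs with value iteration, in both directions.

  By backward recursion a policy has a cost \<open>cost_to_go\<close> over finitely many periods from a given
  time. Telescoping along the Ionescu-Tulcea kernels identifies it with the expected cost
  accumulated under the law of the process, so the cost of a policy is the supremum of its
  finite-horizon costs (\<open>policy_cost_eq_SUP\<close>). Every \<open>v n\<close> lies below the \<open>n\<close>-period cost of every
  policy, and hence \<open>v n \<le> policy_cost\<close> (\<open>value_iter_le_policy_cost\<close>); as this holds for all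
  policies, \<open>v (N + 1)\<close> is also a lower bound for the optimal cost.

  For the upper bound, the growth conditions give \<open>v (n + 1) \<le> v n + c_bar \<gamma>^n w\<close>
  (\<open>value_iter_increment\<close>). As \<open>v (N + 1) = c(\<cdot>, f) + \<alpha> \<integral> v N dQ(\<cdot> | \<cdot>, f)\<close>, the function
  \<open>h = v (N + 1) + c_bar \<gamma>^(N + 1) / (1 - \<gamma>) w\<close> satisfies \<open>T h \<le> h\<close>. The finite-horizon costs of the
  stationary policy \<open>f\<close> are the iterates of the monotone \<open>T\<close> on \<open>0 \<le> h\<close>, so they stay below \<open>h\<close>
  (\<open>policy_cost_first_stage_selector_le\<close>).

  The functions \<open>v n\<close> are infima over possibly uncountable action sets, and their measurability is never
  needed: on a non-measurable function, \<open>nn_integral\<close> is a lower integral, which is monotone and is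
  subadditive as soon as one of the two summands is measurable and finite
  (\<open>nn_integral_add_le_measurable\<close>).
\<close>

section \<open>Integrals\<close>

text \<open>
  The summand \<open>f\<close> need not be measurable. A simple \<open>s \<le> f + g\<close> is dominated by \<open>(s - g) + g\<close>, a sum
  of measurable functions, and \<open>s - g \<le> f\<close>.
\<close>

lemma nn_integral_add_le_measurable:
  fixes f g :: "'b \<Rightarrow> ennreal"
  assumes [measurable]: "g \<in> borel_measurable M" and fin: "\<And>x. x \<in> space M \<Longrightarrow> g x < \<infinity>"
  shows "(\<integral>\<^sup>+x. f x + g x \<partial>M) \<le> (\<integral>\<^sup>+x. f x \<partial>M) + (\<integral>\<^sup>+x. g x \<partial>M)"
  unfolding nn_integral_def[of M "\<lambda>x. f x + g x"]
proof (rule SUP_least)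
  fix s assume "s \<in> {s. simple_function M s \<and> s \<le> (\<lambda>x. f x + g x)}"
  then have s: "simple_function M s" and le: "\<And>x. s x \<le> f x + g x" by (auto simp: le_fun_def)
  have [measurable]: "s \<in> borel_measurable M" using s by (rule borel_measurable_simple_function)
  have "integral\<^sup>S M s = (\<integral>\<^sup>+x. s x \<partial>M)" using s by (simp add: nn_integral_eq_simple_integral)
  also have "\<dots> \<le> (\<integral>\<^sup>+x. (s x - g x) + g x \<partial>M)"
  proof (rule nn_integral_mono)
    fix x show "s x \<le> (s x - g x) + g x"
      by (cases "g x \<le> s x") (simp_all add: diff_add_cancel_ennreal add_increasing)
  qed
  also have "\<dots> = (\<integral>\<^sup>+x. s x - g x \<partial>M) + (\<integral>\<^sup>+x. g x \<partial>M)" by (intro nn_integral_add) auto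
  also have "(\<integral>\<^sup>+x. s x - g x \<partial>M) \<le> (\<integral>\<^sup>+x. f x \<partial>M)"
  proof (rule nn_integral_mono)
    fix x assume "x \<in> space M"
    from fin[OF this] le[of x] show "s x - g x \<le> f x"
      by (metis add.commute ennreal_minus_le_iff infinity_ennreal_def less_irrefl)
  qed
  finally show "integral\<^sup>S M s \<le> (\<integral>\<^sup>+x. f x \<partial>M) + (\<integral>\<^sup>+x. g x \<partial>M)" by (simp add: add_right_mono)
qed

lemma (in Ionescu_Tulcea) nn_integral_C_Suc:
  assumes g: "g \<in> borel_measurable (PiM {0..<Suc n} M)"
  shows "(\<integral>\<^sup>+\<omega>. g \<omega> \<partial>C 0 (Suc n) (\<lambda>_. undefined)) =
    (\<integral>\<^sup>+\<omega>. \<integral>\<^sup>+z. g (fun_upd \<omega> n z) \<partial>P n \<omega> \<partial>C 0 n (\<lambda>_. undefined))"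
proof -
  have u: "(\<lambda>_. undefined) \<in> space (PiM {0..<0} M)" by (simp add: space_PiM)
  have m: "eP n \<in> C 0 n (\<lambda>_. undefined) \<rightarrow>\<^sub>M subprob_algebra (PiM {0..<Suc n} M)"
    using measurable_eP[of n] by (simp add: measurable_cong_sets[OF sets_C[OF u, of n] refl])
  have "(\<integral>\<^sup>+\<omega>. g \<omega> \<partial>C 0 (Suc n) (\<lambda>_. undefined)) =
    (\<integral>\<^sup>+\<omega>. \<integral>\<^sup>+z. g z \<partial>eP n \<omega> \<partial>C 0 n (\<lambda>_. undefined))"
    using nn_integral_bind[OF g m] by simp
  also have "\<dots> = (\<integral>\<^sup>+\<omega>. \<integral>\<^sup>+z. g (fun_upd \<omega> n z) \<partial>P n \<omega> \<partial>C 0 n (\<lambda>_. undefined))"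
    using space_C[OF u, of n] g by (intro nn_integral_cong nn_integral_eP) auto
  finally show ?thesis .
qed

text \<open>The finite-dimensional marginals of the projective limit are the laws \<open>C 0 n\<close>.\<close>

lemma (in Ionescu_Tulcea) nn_integral_lim:
  assumes g: "g \<in> borel_measurable (PiM {0..<n} M)"
  shows "(\<integral>\<^sup>+\<omega>. g (restrict \<omega> {0..<n}) \<partial>PF.lim) = (\<integral>\<^sup>+\<omega>. g \<omega> \<partial>C 0 n (\<lambda>_. undefined))"
proof -
  have u: "(\<lambda>_. undefined) \<in> space (PiM {0..<0} M)" by (simp add: space_PiM)
  have up: "up_to {0..<n} = n"
    by (rule antisym) (simp_all add: up_to_iff_Ico, use up_to[of "{0..<n}"] in auto)
  have "(\<integral>\<^sup>+\<omega>. g (restrict \<omega> {0..<n}) \<partial>PF.lim) =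
      (\<integral>\<^sup>+\<omega>. g \<omega> \<partial>distr PF.lim (PiM {0..<n} M) (\<lambda>\<omega>. restrict \<omega> {0..<n}))"
    by (rule nn_integral_distr[symmetric])
       (simp_all add: measurable_cong_sets[OF PF.sets_lim refl] g measurable_restrict_subset del: restrict_apply)
  also have "\<dots> = (\<integral>\<^sup>+\<omega>. g \<omega> \<partial>CI {0..<n})" by (subst distr_lim) auto
  also have "\<dots> = (\<integral>\<^sup>+\<omega>. g (restrict \<omega> {0..<n}) \<partial>C 0 n (\<lambda>_. undefined))"
    unfolding CI_def up
    by (rule nn_integral_distr)
       (auto intro!: measurable_restrict simp: measurable_cong_sets[OF sets_C[OF u] refl] g)
  also have "\<dots> = (\<integral>\<^sup>+\<omega>. g \<omega> \<partial>C 0 n (\<lambda>_. undefined))"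
    using space_C[OF u, of n]
    by (intro nn_integral_cong) (auto simp: space_PiM PiE_def extensional_restrict)
  finally show ?thesis .
qed

section \<open>Finite-horizon costs of a policy\<close>

text \<open>
  The cost of a period, set to zero off the feasible live pairs, where \<open>cost\<close> is unspecified and
  need not be measurable.
\<close>

definition stage_cost :: "('x, 'a) control_model \<Rightarrow> 'x \<times> 'a \<Rightarrow> ennreal" where
  "stage_cost M z = (if z \<in> live_graph M then ennreal (cost M z) else 0)"

text \<open>
  The expected cost of \<open>k\<close> periods under \<open>\<pi>\<close>, starting in state \<open>y\<close> at time \<open>t\<close> and discounted to
  that time. It vanishes at target states, which accounts for the stopping.
\<close>

primrec cost_to_go ::
  "('x::topological_space, 'a::topological_space) control_model \<Rightarrow> (nat \<Rightarrow> 'x \<Rightarrow> 'a measure) \<Rightarrow> nat \<Rightarrow>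
   nat \<Rightarrow> 'x \<Rightarrow> ennreal" where
  "cost_to_go M \<pi> 0 t y = 0"
| "cost_to_go M \<pi> (Suc k) t y =
     (\<integral>\<^sup>+a. stage_cost M (y, a) + ennreal (discount M) *
        (\<integral>\<^sup>+z. cost_to_go M \<pi> k (Suc t) z \<partial>next_state_law M (y, a)) \<partial>decision_law M (\<pi> t) y)
     * indicator (live M) y"

text \<open>The law of the state at time \<open>n\<close>, given the state-action pairs \<open>\<omega>\<close> before time \<open>n\<close>.\<close>

definition entry_law ::
  "('x::topological_space, 'a) control_model \<Rightarrow> 'x \<Rightarrow> nat \<Rightarrow> (nat \<Rightarrow> 'x \<times> 'a) \<Rightarrow> 'x measure" where
  "entry_law M x n \<omega> =
     (case n of 0 \<Rightarrow> return (state_space M) x | Suc j \<Rightarrow> next_state_law M (\<omega> j))"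

text \<open>The indicator of the event that the states at all times before \<open>n\<close> are live.\<close>

definition surviving :: "('x, 'a) control_model \<Rightarrow> nat \<Rightarrow> (nat \<Rightarrow> 'x \<times> 'a) \<Rightarrow> ennreal" where
  "surviving M n \<omega> = (\<Prod>j<n. indicator (live M) (fst (\<omega> j)))"

text \<open>The discounted cost of period \<open>i\<close>, charged only if the target has not been hit by time \<open>i\<close>.\<close>

definition period_cost :: "('x, 'a) control_model \<Rightarrow> nat \<Rightarrow> (nat \<Rightarrow> 'x \<times> 'a) \<Rightarrow> ennreal" where
  "period_cost M i \<omega> = surviving M (Suc i) \<omega> * ennreal (discount M ^ i) * stage_cost M (\<omega> i)"

lemma step_law_entry_law: "step_law M \<pi> x n \<omega> = pair_law M (\<pi> n) (entry_law M x n \<omega>)"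
  by (cases n) (simp_all add: entry_law_def)

locale controlled_process =
  fixes M :: "('x::polish_space, 'a::polish_space) control_model"
    and \<pi> :: "nat \<Rightarrow> 'x \<Rightarrow> 'a measure"
  assumes model: "is_control_model M" and policy: "\<pi> \<in> policies M"
begin

lemma live_sets [measurable]: "live M \<in> sets (state_space M)"
  using model by (auto simp: is_control_model_def live_def state_space_def sets_restrict_space_iff)

lemma space_state_space [simp]: "space (state_space M) = states M"
  by (simp add: state_space_def space_restrict_space)

lemma live_graph_sets [measurable]: "live_graph M \<in> sets (pair_space M)"
  using model by (rule live_graph_in)

lemma discount: "0 < discount M" "discount M < 1"
  using model by (auto simp: is_control_model_def)

lemma measurable_fst_pair_space [measurable]: "fst \<in> pair_space M \<rightarrow>\<^sub>M state_space M"
  by (simp add: pair_space_def)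

lemma decision_law_measurable: "decision_law M (\<pi> t) \<in> state_space M \<rightarrow>\<^sub>M prob_algebra (action_space M)"
  using model policy by (rule decision_meas)

lemma next_state_law_measurable: "next_state_law M \<in> pair_space M \<rightarrow>\<^sub>M prob_algebra (state_space M)"
  using model by (rule next_meas)

lemma stage_cost_measurable [measurable]: "stage_cost M \<in> borel_measurable (pair_space M)"
proof -
  have "(\<lambda>z. (fst z, snd z)) \<in> pair_space M \<rightarrow>\<^sub>M borel \<Otimes>\<^sub>M borel"
    unfolding pair_space_def state_space_def action_space_def
    by (intro measurable_Pair measurable_fst'' measurable_snd'' measurable_restrict_space1) simp_all
  then have "(\<lambda>z. z) \<in> pair_space M \<rightarrow>\<^sub>M borel" by (simp add: borel_prod)
  then have *: "(\<lambda>z. z) \<in> restrict_space (pair_space M) (live_graph M) \<rightarrow>\<^sub>M restrict_space borel (live_graph M)"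
    by (intro measurable_restrict_space2 measurable_restrict_space1) (auto simp: space_restrict_space)
  have "cost M \<in> borel_measurable (restrict_space borel (live_graph M))"
    using model by (simp add: is_control_model_def)
  from measurable_compose[OF * this]
  have [measurable]: "cost M \<in> borel_measurable (restrict_space (pair_space M) (live_graph M))" .
  show ?thesis unfolding stage_cost_def
    using sets.sets_into_space[OF live_graph_sets]
    by (subst measurable_If_restrict_space_iff) (auto simp: Int_absorb2)
qed

lemma prob_space_decision_law:
  assumes "y \<in> live M"
  shows "prob_space (decision_law M (\<pi> t) y)"
proof -
  have "y \<in> space (state_space M)" using assms by (simp add: live_def)
  then have "decision_law M (\<pi> t) y \<in> space (prob_algebra (action_space M))"
    by (rule measurable_space[OF decision_law_measurable])
  then show ?thesis by (simp add: space_prob_algebra)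
qed

lemma nn_integral_next_state_law_measurable [measurable]:
  assumes "g \<in> borel_measurable (state_space M)"
  shows "(\<lambda>z. \<integral>\<^sup>+y. g y \<partial>next_state_law M z) \<in> borel_measurable (pair_space M)"
  using measurable_prob_algebraD[OF next_state_law_measurable]
    nn_integral_measurable_subprob_algebra[OF assms]
  by (rule measurable_compose)

lemma cost_to_go_measurable [measurable]: "cost_to_go M \<pi> k t \<in> borel_measurable (state_space M)"
proof (induction k arbitrary: t)
  case 0 show ?case by (simp add: cost_to_go.simps(1)[abs_def])
next
  case (Suc k)
  note [measurable] = Suc measurable_prob_algebraD[OF decision_law_measurable]
  have [measurable]: "(\<lambda>y. \<integral>\<^sup>+a. stage_cost M (y, a) + ennreal (discount M) *
        (\<integral>\<^sup>+z. cost_to_go M \<pi> k (Suc t) z \<partial>next_state_law M (y, a)) \<partial>decision_law M (\<pi> t) y)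
      \<in> borel_measurable (state_space M)"
    by (rule nn_integral_measurable_subprob_algebra2[where N="action_space M"])
       (simp_all add: pair_space_def[symmetric] split_beta' , measurable)
  show ?case unfolding cost_to_go.simps[abs_def] by measurable
qed

lemma cost_to_go_off_live: "y \<notin> live M \<Longrightarrow> cost_to_go M \<pi> k t y = 0"
  by (cases k) simp_all

lemma nn_integral_pair_law:
  assumes \<nu>: "\<nu> \<in> space (prob_algebra (state_space M))"
    and g [measurable]: "g \<in> borel_measurable (pair_space M)"
  shows "(\<integral>\<^sup>+z. g z \<partial>pair_law M (\<pi> t) \<nu>) = (\<integral>\<^sup>+y. \<integral>\<^sup>+a. g (y, a) \<partial>decision_law M (\<pi> t) y \<partial>\<nu>)"
proof -
  have s\<nu>: "sets \<nu> = sets (state_space M)" using \<nu> by (simp add: space_prob_algebra)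
  note [measurable] = decision_law_measurable
  have "(\<lambda>y. decision_law M (\<pi> t) y \<bind> (\<lambda>a. return (pair_space M) (y, a)))
      \<in> state_space M \<rightarrow>\<^sub>M prob_algebra (pair_space M)"
    unfolding pair_space_def by measurable
  then have m: "(\<lambda>y. decision_law M (\<pi> t) y \<bind> (\<lambda>a. return (pair_space M) (y, a)))
      \<in> \<nu> \<rightarrow>\<^sub>M subprob_algebra (pair_space M)"
    using measurable_prob_algebraD measurable_cong_sets[OF s\<nu> refl] by blast
  have "(\<integral>\<^sup>+z. g z \<partial>pair_law M (\<pi> t) \<nu>) =
      (\<integral>\<^sup>+y. \<integral>\<^sup>+z. g z \<partial>(decision_law M (\<pi> t) y \<bind> (\<lambda>a. return (pair_space M) (y, a))) \<partial>\<nu>)"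
    unfolding pair_law_def by (rule nn_integral_bind[OF g m])
  also have "\<dots> = (\<integral>\<^sup>+y. \<integral>\<^sup>+a. g (y, a) \<partial>decision_law M (\<pi> t) y \<partial>\<nu>)"
  proof (rule nn_integral_cong)
    fix y assume "y \<in> space \<nu>"
    then have y: "y \<in> space (state_space M)" using sets_eq_imp_space_eq[OF s\<nu>] by simp
    have sd: "sets (decision_law M (\<pi> t) y) = sets (action_space M)"
      using measurable_space[OF decision_law_measurable y] by (simp add: space_prob_algebra)
    have "(\<lambda>a. return (pair_space M) (y, a)) \<in> action_space M \<rightarrow>\<^sub>M subprob_algebra (pair_space M)"
      using y unfolding pair_space_def by measurable
    then have k: "(\<lambda>a. return (pair_space M) (y, a)) \<in> decision_law M (\<pi> t) y \<rightarrow>\<^sub>M subprob_algebra (pair_space M)"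
      using measurable_cong_sets[OF sd refl] by blast
    show "(\<integral>\<^sup>+z. g z \<partial>(decision_law M (\<pi> t) y \<bind> (\<lambda>a. return (pair_space M) (y, a)))) =
       (\<integral>\<^sup>+a. g (y, a) \<partial>decision_law M (\<pi> t) y)"
      unfolding nn_integral_bind[OF g k]
      using y sets_eq_imp_space_eq[OF sd]
      by (intro nn_integral_cong nn_integral_return[OF _ g])
         (auto simp: pair_space_def space_pair_measure)
  qed
  finally show ?thesis .
qed

lemma decision_law_feasible:
  assumes y: "y \<in> live M"
  shows "AE a in decision_law M (\<pi> t) y. a \<in> feasible M y"
proof -
  interpret prob_space "decision_law M (\<pi> t) y" using y by (rule prob_space_decision_law)
  have "emeasure (decision_law M (\<pi> t) y) (feasible M y) = 1"
    using policy y by (auto simp: policies_def decision_law_def)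
  \<comment> \<open>Non-measurable sets have \<open>emeasure\<close> zero.\<close>
  moreover have "feasible M y \<in> sets (decision_law M (\<pi> t) y)"
    using calculation emeasure_notin_sets by fastforce
  ultimately show ?thesis by (simp add: AE_in_set_eq_1 emeasure_eq_measure)
qed

lemma next_cost_to_go:
  assumes "(y, a) \<in> live_graph M"
  shows "(\<integral>\<^sup>+z. cost_to_go M \<pi> k t z \<partial>next_state_law M (y, a)) =
    (\<integral>\<^sup>+z\<in>live M. cost_to_go M \<pi> k t z \<partial>trans_law M (y, a))"
  using assms by (auto simp: next_state_law_def cost_to_go_off_live intro!: nn_integral_cong split: split_indicator)

lemma value_iter_le_cost_to_go:
  assumes "y \<in> live M"
  shows "value_iter M k y \<le> cost_to_go M \<pi> k t y"
  using assms
proof (induction k arbitrary: t y)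
  case (Suc k)
  interpret prob_space "decision_law M (\<pi> t) y" using Suc.prems by (rule prob_space_decision_law)
  have "value_iter M (Suc k) y = (\<integral>\<^sup>+a. value_iter M (Suc k) y \<partial>decision_law M (\<pi> t) y)"
    by (simp add: emeasure_space_1 del: value_iter.simps)
  also have "\<dots> \<le> (\<integral>\<^sup>+a. stage_cost M (y, a) + ennreal (discount M) *
        (\<integral>\<^sup>+z. cost_to_go M \<pi> k (Suc t) z \<partial>next_state_law M (y, a)) \<partial>decision_law M (\<pi> t) y)"
  proof (rule nn_integral_mono_AE, use decision_law_feasible[OF Suc.prems] in eventually_elim)
    case (elim a)
    then have ya: "(y, a) \<in> live_graph M" using Suc.prems by (simp add: live_graph_def)
    have "value_iter M (Suc k) y \<le> ennreal (cost M (y, a)) +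
        ennreal (discount M) * (\<integral>\<^sup>+z\<in>live M. value_iter M k z \<partial>trans_law M (y, a))"
      using elim by (auto intro: INF_lower)
    also have "\<dots> \<le> ennreal (cost M (y, a)) +
        ennreal (discount M) * (\<integral>\<^sup>+z\<in>live M. cost_to_go M \<pi> k (Suc t) z \<partial>trans_law M (y, a))"
      by (intro add_left_mono mult_left_mono nn_integral_mono) (auto simp: Suc.IH split: split_indicator)
    finally show ?case using ya by (simp add: stage_cost_def next_cost_to_go del: value_iter.simps)
  qed
  finally show ?case using Suc.prems by (simp del: value_iter.simps)
qed simp

section \<open>Cost of a policy as a supremum of finite-horizon costs\<close>

lemma entry_law_measurable:
  assumes "x \<in> states M"
  shows "entry_law M x n \<in> PiM {0..<n} (\<lambda>_. pair_space M) \<rightarrow>\<^sub>M prob_algebra (state_space M)"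
proof (cases n)
  case 0
  then show ?thesis using assms
    by (auto simp: entry_law_def[abs_def] space_prob_algebra intro!: prob_space_return)
next
  case (Suc j)
  have "(\<lambda>\<omega>. \<omega> j) \<in> PiM {0..<Suc j} (\<lambda>_. pair_space M) \<rightarrow>\<^sub>M pair_space M"
    by (rule measurable_component_singleton) simp
  from measurable_compose[OF this next_state_law_measurable]
  show ?thesis by (simp add: Suc entry_law_def[abs_def])
qed

lemma surviving_measurable [measurable]:
  assumes "n \<le> m"
  shows "surviving M n \<in> borel_measurable (PiM {0..<m} (\<lambda>_. pair_space M))"
proof -
  have "(\<lambda>\<omega>. indicator (live M) (fst (\<omega> j)) :: ennreal) \<in> borel_measurable (PiM {0..<m} (\<lambda>_. pair_space M))"
    if "j < n" for j
  proof -
    have [measurable]: "(\<lambda>\<omega>. \<omega> j) \<in> PiM {0..<m} (\<lambda>_. pair_space M) \<rightarrow>\<^sub>M pair_space M"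
      using that assms by (intro measurable_component_singleton) simp
    show ?thesis by measurable
  qed
  then show ?thesis unfolding surviving_def[abs_def] by (intro borel_measurable_prod_ennreal) simp
qed

lemma period_cost_measurable [measurable]:
  assumes "i < m"
  shows "period_cost M i \<in> borel_measurable (PiM {0..<m} (\<lambda>_. pair_space M))"
proof -
  have [measurable]: "(\<lambda>\<omega>. \<omega> i) \<in> PiM {0..<m} (\<lambda>_. pair_space M) \<rightarrow>\<^sub>M pair_space M"
    using assms by (intro measurable_component_singleton) simp
  have [measurable]: "surviving M (Suc i) \<in> borel_measurable (PiM {0..<m} (\<lambda>_. pair_space M))"
    using assms by (intro surviving_measurable) simp
  show ?thesis unfolding period_cost_def[abs_def] by measurable
qed


lemma hitting_time_greater_iff: "enat i < hitting_time M \<omega> \<longleftrightarrow> (\<forall>j\<le>i. fst (\<omega> j) \<notin> target M)"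
proof -
  have "enat i < hitting_time M \<omega> \<longleftrightarrow> (\<forall>j. fst (\<omega> j) \<in> target M \<longrightarrow> enat (Suc i) \<le> enat j)"
    unfolding Suc_ile_eq[symmetric] hitting_time_def le_Inf_iff by auto
  then show ?thesis by (auto simp: Suc_le_eq not_le[symmetric])
qed

lemma surviving_cong: "(\<And>j. j < n \<Longrightarrow> \<omega> j = \<omega>' j) \<Longrightarrow> surviving M n \<omega> = surviving M n \<omega>'"
  by (simp add: surviving_def)

lemma period_cost_cong: "(\<And>j. j \<le> i \<Longrightarrow> \<omega> j = \<omega>' j) \<Longrightarrow> period_cost M i \<omega> = period_cost M i \<omega>'"
  by (simp add: period_cost_def surviving_cong[of "Suc i" \<omega> \<omega>'])

text \<open>
  The cost accumulated before time \<open>m\<close> along \<open>\<omega>\<close>, plus the conditional expectation, given \<open>\<omega>\<close>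
  before time \<open>m\<close>, of the cost of the next \<open>k\<close> periods.
\<close>

definition continued_cost :: "'x \<Rightarrow> nat \<Rightarrow> nat \<Rightarrow> (nat \<Rightarrow> 'x \<times> 'a) \<Rightarrow> ennreal" where
  "continued_cost x m k \<omega> = (\<Sum>i<m. period_cost M i \<omega>) +
     surviving M m \<omega> * ennreal (discount M ^ m) * (\<integral>\<^sup>+y. cost_to_go M \<pi> k m y \<partial>entry_law M x m \<omega>)"

lemma continued_cost_measurable:
  assumes "x \<in> states M"
  shows "continued_cost x m k \<in> borel_measurable (PiM {0..<m} (\<lambda>_. pair_space M))"
proof -
  have [measurable]: "period_cost M i \<in> borel_measurable (PiM {0..<m} (\<lambda>_. pair_space M))" if "i < m" for i
    using that by (rule period_cost_measurable)
  have [measurable]: "surviving M m \<in> borel_measurable (PiM {0..<m} (\<lambda>_. pair_space M))"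
    by (rule surviving_measurable) simp
  have [measurable]: "(\<lambda>\<omega>. \<integral>\<^sup>+y. cost_to_go M \<pi> k m y \<partial>entry_law M x m \<omega>)
      \<in> borel_measurable (PiM {0..<m} (\<lambda>_. pair_space M))"
    using measurable_prob_algebraD[OF entry_law_measurable[OF assms]]
    by (rule measurable_compose[OF _ nn_integral_measurable_subprob_algebra]) measurable
  show ?thesis unfolding continued_cost_def[abs_def] by measurable
qed

text \<open>
  The tower property for one period; it makes the expectation of \<open>continued_cost x m k\<close> depend on
  \<open>m + k\<close> only.
\<close>

lemma continued_cost_step:
  assumes x: "x \<in> states M" and \<omega>: "\<omega> \<in> space (PiM {0..<m} (\<lambda>_. pair_space M))"
  shows "(\<integral>\<^sup>+z. continued_cost x (Suc m) k (fun_upd \<omega> m z) \<partial>step_law M \<pi> x m \<omega>) =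
    continued_cost x m (Suc k) \<omega>"
proof -
  interpret IT: Ionescu_Tulcea "step_law M \<pi> x" "\<lambda>_. pair_space M"
    using model policy x by (rule Ionescu_Tulcea_step_law)
  interpret prob_space "step_law M \<pi> x m \<omega>" using \<omega> by (rule IT.prob_space_P)
  have sets_step: "sets (step_law M \<pi> x m \<omega>) = sets (pair_space M)" using \<omega> by (rule IT.sets_P)
  have \<nu>: "entry_law M x m \<omega> \<in> space (prob_algebra (state_space M))"
    using measurable_space[OF entry_law_measurable[OF x] \<omega>] .
  \<comment> \<open>Given \<open>\<omega>\<close>, the integrand is affine in the function \<open>h\<close> of the new pair alone.\<close>
  define S where "S = (\<Sum>i<m. period_cost M i \<omega>)"
  define c where "c = surviving M m \<omega> * ennreal (discount M ^ m)"
  define h where "h z = indicator (live M) (fst z) * (stage_cost M z + ennreal (discount M) *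
      (\<integral>\<^sup>+y. cost_to_go M \<pi> k (Suc m) y \<partial>next_state_law M z))" for z
  have h: "h \<in> borel_measurable (pair_space M)" unfolding h_def[abs_def] by measurable
  then have h': "h \<in> borel_measurable (step_law M \<pi> x m \<omega>)"
    by (simp add: measurable_cong_sets[OF sets_step refl])
  have "continued_cost x (Suc m) k (fun_upd \<omega> m z) = S + c * h z" for z
  proof -
    have "period_cost M i (fun_upd \<omega> m z) = period_cost M i \<omega>" if "i < m" for i
      using that by (intro period_cost_cong) auto
    moreover have "surviving M m (fun_upd \<omega> m z) = surviving M m \<omega>"
      by (intro surviving_cong) auto
    ultimately show ?thesis
      using discount
      by (simp add: continued_cost_def period_cost_def surviving_def S_def c_def h_def entry_law_def
          ennreal_mult algebra_simps)
  qed
  then have "(\<integral>\<^sup>+z. continued_cost x (Suc m) k (fun_upd \<omega> m z) \<partial>step_law M \<pi> x m \<omega>) =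
      S + c * (\<integral>\<^sup>+z. h z \<partial>step_law M \<pi> x m \<omega>)"
    using h' by (simp add: nn_integral_add nn_integral_cmult emeasure_space_1)
  also have "(\<integral>\<^sup>+z. h z \<partial>step_law M \<pi> x m \<omega>) =
      (\<integral>\<^sup>+y. \<integral>\<^sup>+a. h (y, a) \<partial>decision_law M (\<pi> m) y \<partial>entry_law M x m \<omega>)"
    unfolding step_law_entry_law by (rule nn_integral_pair_law[OF \<nu> h])
  also have "\<dots> = (\<integral>\<^sup>+y. cost_to_go M \<pi> (Suc k) m y \<partial>entry_law M x m \<omega>)"
    by (intro nn_integral_cong) (auto simp: h_def split: split_indicator)
  finally show ?thesis by (simp only: continued_cost_def S_def c_def)
qed

lemma nn_integral_period_costs:
  assumes x: "x \<in> states M"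
  shows "(\<integral>\<^sup>+\<omega>. (\<Sum>i<n. period_cost M i \<omega>) \<partial>process_law M \<pi> x) = cost_to_go M \<pi> n 0 x"
proof -
  interpret IT: Ionescu_Tulcea "step_law M \<pi> x" "\<lambda>_. pair_space M"
    using model policy x by (rule Ionescu_Tulcea_step_law)
  have E: "(\<integral>\<^sup>+\<omega>. continued_cost x m k \<omega> \<partial>IT.C 0 m (\<lambda>_. undefined)) = cost_to_go M \<pi> (m + k) 0 x" for m k
  proof (induction m arbitrary: k)
    case 0
    have "(\<integral>\<^sup>+\<omega>. continued_cost x 0 k \<omega> \<partial>IT.C 0 0 (\<lambda>_. undefined)) = continued_cost x 0 k (\<lambda>_. undefined)"
      unfolding IT.C.simps using continued_cost_measurable[OF x, of 0 k]
      by (intro nn_integral_return) (simp_all add: space_PiM)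
    also have "\<dots> = cost_to_go M \<pi> k 0 x"
      using x by (simp add: continued_cost_def surviving_def entry_law_def nn_integral_return)
    finally show ?case by simp
  next
    case (Suc m)
    have u: "(\<lambda>_::nat. undefined) \<in> space (PiM {0..<0} (\<lambda>_. pair_space M))" by (simp add: space_PiM)
    have "(\<integral>\<^sup>+\<omega>. continued_cost x (Suc m) k \<omega> \<partial>IT.C 0 (Suc m) (\<lambda>_. undefined)) =
        (\<integral>\<^sup>+\<omega>. continued_cost x m (Suc k) \<omega> \<partial>IT.C 0 m (\<lambda>_. undefined))"
      unfolding IT.nn_integral_C_Suc[OF continued_cost_measurable[OF x]]
      using IT.space_C[OF u, of m] by (intro nn_integral_cong continued_cost_step[OF x]) simp
    then show ?case using Suc.IH[of "Suc k"] by simp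
  qed
  have m: "(\<lambda>\<omega>. \<Sum>i<n. period_cost M i \<omega>) \<in> borel_measurable (PiM {0..<n} (\<lambda>_. pair_space M))"
    by (intro borel_measurable_sum period_cost_measurable) simp
  have "(\<integral>\<^sup>+\<omega>. (\<Sum>i<n. period_cost M i \<omega>) \<partial>process_law M \<pi> x) =
      (\<integral>\<^sup>+\<omega>. (\<Sum>i<n. period_cost M i (restrict \<omega> {0..<n})) \<partial>process_law M \<pi> x)"
    by (intro nn_integral_cong sum.cong refl period_cost_cong) auto
  also have "\<dots> = (\<integral>\<^sup>+\<omega>. (\<Sum>i<n. period_cost M i \<omega>) \<partial>IT.C 0 n (\<lambda>_. undefined))"
    unfolding process_law_def by (rule IT.nn_integral_lim[OF m])
  also have "\<dots> = cost_to_go M \<pi> n 0 x"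
    using E[of n 0] by (simp add: continued_cost_def)
  finally show ?thesis .
qed

text \<open>
  Off the feasible pairs the integrand defining \<open>policy_cost\<close> may fail to be measurable; as such
  pairs almost surely do not occur before the target is hit, \<open>period_cost\<close> can replace it.
\<close>

lemma process_law_feasible:
  assumes x: "x \<in> states M"
  shows "AE \<omega> in process_law M \<pi> x. fst (\<omega> i) \<in> live M \<longrightarrow> \<omega> i \<in> live_graph M"
proof -
  interpret IT: Ionescu_Tulcea "step_law M \<pi> x" "\<lambda>_. pair_space M"
    using model policy x by (rule Ionescu_Tulcea_step_law)
  have u: "(\<lambda>_::nat. undefined) \<in> space (PiM {0..<0} (\<lambda>_. pair_space M))" by (simp add: space_PiM)
  \<comment> \<open>The indicator of the infeasible pairs with a live state.\<close>
  define b :: "'x \<times> 'a \<Rightarrow> ennreal" where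
    "b z = indicator (live M) (fst z) * indicator (- live_graph M) z" for z
  have [measurable]: "(\<lambda>z. indicator (- live_graph M) z :: ennreal) \<in> borel_measurable (pair_space M)"
    unfolding indicator_def by measurable
  have b [measurable]: "b \<in> borel_measurable (pair_space M)" unfolding b_def[abs_def] by measurable
  have [measurable]: "(\<lambda>\<omega>. \<omega> i) \<in> PiM {0..<Suc i} (\<lambda>_. pair_space M) \<rightarrow>\<^sub>M pair_space M"
    by (intro measurable_component_singleton) simp
  have [measurable]: "(\<lambda>\<omega>. \<omega> i) \<in> process_law M \<pi> x \<rightarrow>\<^sub>M pair_space M"
    unfolding process_law_def measurable_cong_sets[OF IT.PF.sets_lim refl]
    by (intro measurable_component_singleton) simp
  have "(\<integral>\<^sup>+\<omega>. b (\<omega> i) \<partial>process_law M \<pi> x) = (\<integral>\<^sup>+\<omega>. b (restrict \<omega> {0..<Suc i} i) \<partial>process_law M \<pi> x)"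
    by simp
  also have "\<dots> = (\<integral>\<^sup>+\<omega>. b (\<omega> i) \<partial>IT.C 0 (Suc i) (\<lambda>_. undefined))"
    unfolding process_law_def by (rule IT.nn_integral_lim) measurable
  also have "\<dots> = (\<integral>\<^sup>+\<omega>. \<integral>\<^sup>+z. b z \<partial>step_law M \<pi> x i \<omega> \<partial>IT.C 0 i (\<lambda>_. undefined))"
    by (subst IT.nn_integral_C_Suc) (simp_all, measurable)
  also have "\<dots> = (\<integral>\<^sup>+\<omega>. 0 \<partial>IT.C 0 i (\<lambda>_. undefined))"
  proof (rule nn_integral_cong)
    fix \<omega> assume "\<omega> \<in> space (IT.C 0 i (\<lambda>_. undefined))"
    then have \<omega>: "\<omega> \<in> space (PiM {0..<i} (\<lambda>_. pair_space M))" using IT.space_C[OF u, of i] by simp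
    have \<nu>: "entry_law M x i \<omega> \<in> space (prob_algebra (state_space M))"
      using measurable_space[OF entry_law_measurable[OF x] \<omega>] .
    have "(\<integral>\<^sup>+a. b (y, a) \<partial>decision_law M (\<pi> i) y) = 0" for y
    proof (cases "y \<in> live M")
      case True
      have "(\<integral>\<^sup>+a. b (y, a) \<partial>decision_law M (\<pi> i) y) = (\<integral>\<^sup>+a. 0 \<partial>decision_law M (\<pi> i) y)"
      proof (rule nn_integral_cong_AE, use decision_law_feasible[OF True] in eventually_elim)
        case (elim a)
        then show ?case using True by (simp add: b_def live_graph_def)
      qed
      then show ?thesis by simp
    qed (simp add: b_def)
    then show "(\<integral>\<^sup>+z. b z \<partial>step_law M \<pi> x i \<omega>) = 0"
      unfolding step_law_entry_law nn_integral_pair_law[OF \<nu> b] by simp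
  qed
  also have "\<dots> = 0" by simp
  finally have "AE \<omega> in process_law M \<pi> x. b (\<omega> i) = 0"
    by (subst (asm) nn_integral_0_iff_AE) simp_all
  then show ?thesis by eventually_elim (auto simp: b_def split: split_indicator_asm)
qed

lemma policy_cost_eq_SUP:
  assumes x: "x \<in> states M"
  shows "policy_cost M \<pi> x = (SUP n. cost_to_go M \<pi> n 0 x)"
proof -
  interpret IT: Ionescu_Tulcea "step_law M \<pi> x" "\<lambda>_. pair_space M"
    using model policy x by (rule Ionescu_Tulcea_step_law)
  have sets_law: "sets (process_law M \<pi> x) = sets (PiM UNIV (\<lambda>_. pair_space M))"
    unfolding process_law_def by (rule IT.PF.sets_lim)
  have m: "period_cost M i \<in> borel_measurable (process_law M \<pi> x)" for i
  proof -
    have "(\<lambda>\<omega>. restrict \<omega> {0..<Suc i}) \<in> process_law M \<pi> x \<rightarrow>\<^sub>M PiM {0..<Suc i} (\<lambda>_. pair_space M)"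
      unfolding measurable_cong_sets[OF sets_law refl] by (rule measurable_restrict_subset) simp
    from measurable_compose[OF this period_cost_measurable, of i]
    have "(\<lambda>\<omega>. period_cost M i (restrict \<omega> {0..<Suc i})) \<in> borel_measurable (process_law M \<pi> x)" by simp
    moreover have "period_cost M i (restrict \<omega> {0..<Suc i}) = period_cost M i \<omega>" for \<omega>
      by (intro period_cost_cong) auto
    ultimately show ?thesis by simp
  qed
  have "AE \<omega> in process_law M \<pi> x. \<forall>i. fst (\<omega> i) \<in> live M \<longrightarrow> \<omega> i \<in> live_graph M"
    using process_law_feasible[OF x] by (simp add: AE_all_countable)
  moreover have "AE \<omega> in process_law M \<pi> x. \<forall>i. fst (\<omega> i) \<in> states M"
    using sets_eq_imp_space_eq[OF sets_law]
    by (intro AE_I2) (auto simp: space_PiM pair_space_def space_pair_measure PiE_iff mem_Times_iff)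
  ultimately have "AE \<omega> in process_law M \<pi> x.
      (\<Sum>i. if enat i < hitting_time M \<omega> then ennreal (discount M ^ i * cost M (\<omega> i)) else 0) =
      (\<Sum>i. period_cost M i \<omega>)"
  proof eventually_elim
    case (elim \<omega>)
    have "(if enat i < hitting_time M \<omega> then ennreal (discount M ^ i * cost M (\<omega> i)) else 0) =
        period_cost M i \<omega>" for i
    proof (cases "enat i < hitting_time M \<omega>")
      case True
      then have "fst (\<omega> j) \<in> live M" if "j \<le> i" for j
        using elim that by (auto simp: hitting_time_greater_iff live_def)
      moreover from this have "\<omega> i \<in> live_graph M" using elim by blast
      ultimately show ?thesis
        using True discount
        by (simp add: period_cost_def surviving_def stage_cost_def ennreal_mult')
    next
      case False
      then obtain j where "j \<le> i" "fst (\<omega> j) \<in> target M" by (auto simp: hitting_time_greater_iff)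
      then have "surviving M (Suc i) \<omega> = 0"
        unfolding surviving_def by (intro prod_zero) (auto simp: live_def intro!: bexI[of _ j])
      then show ?thesis using False by (simp add: period_cost_def)
    qed
    then show ?case by simp
  qed
  then have "policy_cost M \<pi> x = (\<integral>\<^sup>+\<omega>. (\<Sum>i. period_cost M i \<omega>) \<partial>process_law M \<pi> x)"
    unfolding policy_cost_def by (rule nn_integral_cong_AE)
  also have "\<dots> = (\<Sum>i. \<integral>\<^sup>+\<omega>. period_cost M i \<omega> \<partial>process_law M \<pi> x)"
    by (rule nn_integral_suminf) (rule m)
  also have "\<dots> = (SUP n. \<Sum>i<n. \<integral>\<^sup>+\<omega>. period_cost M i \<omega> \<partial>process_law M \<pi> x)"
    by (rule suminf_eq_SUP)
  also have "\<dots> = (SUP n. cost_to_go M \<pi> n 0 x)"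
    using m by (simp add: nn_integral_sum[symmetric] nn_integral_period_costs[OF x])
  finally show ?thesis .
qed

lemma value_iter_le_policy_cost:
  assumes "x \<in> live M"
  shows "value_iter M n x \<le> policy_cost M \<pi> x"
proof -
  have "x \<in> states M" using assms by (simp add: live_def)
  then show ?thesis
    unfolding policy_cost_eq_SUP[OF \<open>x \<in> states M\<close>]
    by (intro SUP_upper2[of n] value_iter_le_cost_to_go assms) simp
qed

end


section \<open>Weighted bounds on value iteration\<close>

text \<open>
  Control models whose cost is at most \<open>c_bar w\<close> and whose transitions enlarge the mean of the
  weight \<open>w\<close> by a factor \<open>\<beta>\<close> at most.
\<close>

locale weighted_control_model =
  fixes M :: "('x::polish_space, 'a::polish_space) control_model"
    and c_bar \<beta> :: real and w :: "'x \<Rightarrow> real"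
  assumes model: "is_control_model M"
    and c_bar: "0 < c_bar" and \<beta>: "1 \<le> \<beta>" "\<beta> < 1 / discount M"
    and w_measurable: "w \<in> borel_measurable (restrict_space borel (live M))"
    and w_ge_1: "y \<in> live M \<Longrightarrow> 1 \<le> w y"
    and cost_le: "(y, a) \<in> live_graph M \<Longrightarrow> cost M (y, a) \<le> c_bar * w y"
    and drift: "(y, a) \<in> live_graph M \<Longrightarrow>
      (\<integral>\<^sup>+u\<in>live M. ennreal (w u) \<partial>trans_law M (y, a)) \<le> ennreal (\<beta> * w y)"
begin

text \<open>The contraction factor of discounted transitions in the \<open>w\<close>-weighted norm.\<close>

definition modulus :: real where "modulus = discount M * \<beta>"

lemma discount: "0 < discount M" "discount M < 1"
  using model by (auto simp: is_control_model_def)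

lemma modulus: "0 < modulus" "modulus < 1"
  using \<beta> discount by (simp_all add: modulus_def pos_less_divide_eq mult.commute)

text \<open>Neither \<open>p\<close> nor \<open>q\<close> needs to be measurable.\<close>

lemma discounted_integral_perturbation:
  assumes z: "(y, a) \<in> live_graph M" and \<kappa>: "0 \<le> \<kappa>"
    and le: "\<And>u. u \<in> live M \<Longrightarrow> p u \<le> q u + ennreal (\<kappa> * w u)"
  shows "ennreal (discount M) * (\<integral>\<^sup>+u\<in>live M. p u \<partial>trans_law M (y, a)) \<le>
    ennreal (discount M) * (\<integral>\<^sup>+u\<in>live M. q u \<partial>trans_law M (y, a)) + ennreal (\<kappa> * modulus * w y)"
proof -
  have y: "y \<in> live M" using z by (simp add: live_graph_def)
  have "(y, a) \<in> space (restrict_space borel (feasible_graph M))"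
    using z by (auto simp: live_graph_def feasible_graph_def live_def space_restrict_space)
  moreover have "trans_law M \<in> restrict_space borel (feasible_graph M) \<rightarrow>\<^sub>M prob_algebra (state_space M)"
    using model by (simp add: is_control_model_def)
  ultimately have "trans_law M (y, a) \<in> space (prob_algebra (state_space M))"
    by (rule measurable_space[rotated])
  then have sets_Q: "sets (trans_law M (y, a)) = sets (state_space M)"
    by (simp add: space_prob_algebra)
  have L: "live M \<in> sets (state_space M)"
    using model by (auto simp: is_control_model_def live_def state_space_def sets_restrict_space_iff)
  have "restrict_space (state_space M) (live M) = restrict_space borel (live M)"
  proof -
    have "states M \<in> sets borel" "live M \<in> sets borel" "states M \<inter> live M = live M"
      using model by (auto simp: is_control_model_def live_def)
    then show ?thesis by (simp add: state_space_def restrict_restrict_space)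
  qed
  then have "(\<lambda>u. ennreal (w u)) \<in> borel_measurable (restrict_space (state_space M) (live M))"
    using w_measurable by simp
  then have "(\<lambda>u. ennreal (w u) * indicator (live M) u) \<in> borel_measurable (state_space M)"
    using L by (subst (asm) borel_measurable_restrict_space_iff_ennreal) auto
  then have [measurable]: "(\<lambda>u. ennreal (w u) * indicator (live M) u) \<in> borel_measurable (trans_law M (y, a))"
    by (simp add: measurable_cong_sets[OF sets_Q refl])
  have "(\<integral>\<^sup>+u\<in>live M. p u \<partial>trans_law M (y, a)) \<le>
      (\<integral>\<^sup>+u. q u * indicator (live M) u + ennreal \<kappa> * (ennreal (w u) * indicator (live M) u) \<partial>trans_law M (y, a))"
    using le \<kappa> by (intro nn_integral_mono) (auto simp: ennreal_mult' split: split_indicator)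
  also have "\<dots> \<le> (\<integral>\<^sup>+u\<in>live M. q u \<partial>trans_law M (y, a)) +
      (\<integral>\<^sup>+u. ennreal \<kappa> * (ennreal (w u) * indicator (live M) u) \<partial>trans_law M (y, a))"
    by (rule nn_integral_add_le_measurable) (measurable, auto simp: ennreal_mult_less_top split: split_indicator)
  also have "(\<integral>\<^sup>+u. ennreal \<kappa> * (ennreal (w u) * indicator (live M) u) \<partial>trans_law M (y, a)) =
      ennreal \<kappa> * (\<integral>\<^sup>+u\<in>live M. ennreal (w u) \<partial>trans_law M (y, a))"
    by (rule nn_integral_cmult) measurable
  also have "\<dots> \<le> ennreal \<kappa> * ennreal (\<beta> * w y)"
    by (intro mult_left_mono drift z) simp
  finally have "ennreal (discount M) * (\<integral>\<^sup>+u\<in>live M. p u \<partial>trans_law M (y, a)) \<le>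
      ennreal (discount M) * ((\<integral>\<^sup>+u\<in>live M. q u \<partial>trans_law M (y, a)) + ennreal \<kappa> * ennreal (\<beta> * w y))"
    by (rule mult_left_mono) simp_all
  also have "\<dots> = ennreal (discount M) * (\<integral>\<^sup>+u\<in>live M. q u \<partial>trans_law M (y, a)) + ennreal (\<kappa> * modulus * w y)"
  proof -
    have "ennreal (discount M) * (ennreal \<kappa> * ennreal (\<beta> * w y)) = ennreal (\<kappa> * modulus * w y)"
      using \<kappa> discount \<beta> w_ge_1[OF y]
      by (simp add: ennreal_mult[symmetric] modulus_def mult_ac)
    then show ?thesis by (simp only: distrib_left)
  qed
  finally show ?thesis .
qed

lemma value_iter_increment:
  assumes "y \<in> live M"
  shows "value_iter M (Suc n) y \<le> value_iter M n y + ennreal (c_bar * modulus ^ n * w y)"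
  using assms
proof (induction n arbitrary: y)
  case 0
  then obtain a where a: "a \<in> feasible M y"
    using model by (auto simp: is_control_model_def live_def)
  then have "(y, a) \<in> live_graph M" using 0 by (simp add: live_graph_def)
  have "value_iter M (Suc 0) y \<le> ennreal (cost M (y, a))"
    using a by (auto intro: INF_lower2)
  also have "\<dots> \<le> ennreal (c_bar * w y)"
    using cost_le[OF \<open>(y, a) \<in> live_graph M\<close>] by (rule ennreal_leI)
  finally show ?case by simp
next
  case (Suc n)
  let ?k = "ennreal (c_bar * modulus ^ Suc n * w y)"
  \<comment> \<open>The error term is moved to the left so that the bound can be taken action by action.\<close>
  have "value_iter M (Suc (Suc n)) y - ?k \<le> value_iter M (Suc n) y"
    unfolding value_iter.simps(2)[of M n]
  proof (rule INF_greatest)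
    fix a assume a: "a \<in> feasible M y"
    then have z: "(y, a) \<in> live_graph M" using Suc.prems by (simp add: live_graph_def)
    have "value_iter M (Suc (Suc n)) y \<le> ennreal (cost M (y, a)) +
        ennreal (discount M) * (\<integral>\<^sup>+u\<in>live M. value_iter M (Suc n) u \<partial>trans_law M (y, a))"
      unfolding value_iter.simps(2)[of M "Suc n"] using a by (rule INF_lower)
    also have "\<dots> \<le> ennreal (cost M (y, a)) +
        (ennreal (discount M) * (\<integral>\<^sup>+u\<in>live M. value_iter M n u \<partial>trans_law M (y, a)) +
         ennreal (c_bar * modulus ^ n * modulus * w y))"
      using c_bar modulus by (intro add_left_mono discounted_integral_perturbation z Suc.IH) auto
    finally show "value_iter M (Suc (Suc n)) y - ?k \<le> ennreal (cost M (y, a)) +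
        ennreal (discount M) * (\<integral>\<^sup>+u\<in>live M. value_iter M n u \<partial>trans_law M (y, a))"
      by (simp add: ennreal_minus_le_iff ac_simps del: value_iter.simps)
  qed
  then show ?case by (simp add: ennreal_minus_le_iff add.commute del: value_iter.simps)
qed

lemma value_iter_finite:
  assumes "y \<in> live M"
  shows "value_iter M n y < \<infinity>"
proof (induction n)
  case (Suc n)
  have "value_iter M (Suc n) y \<le> value_iter M n y + ennreal (c_bar * modulus ^ n * w y)"
    using assms by (rule value_iter_increment)
  also have "\<dots> < \<infinity>" using Suc.IH by simp
  finally show ?case .
qed simp

text \<open>
  The right-hand side is the function \<open>h\<close> with \<open>T h \<le> h\<close>; the induction on \<open>k\<close> iterates \<open>T\<close> from \<open>0\<close>.
\<close>

lemma cost_to_go_first_stage_selector_le: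
  assumes f: "first_stage_selector M N f" and y: "y \<in> live M"
  shows "cost_to_go M (stationary M f) k t y \<le>
    value_iter M (Suc N) y + ennreal (c_bar * modulus ^ Suc N / (1 - modulus) * w y)"
  using y
proof (induction k arbitrary: t y)
  case (Suc k)
  have sel: "f \<in> selectors M"
    and v: "value_iter M (Suc N) y = ennreal (cost M (y, f y)) +
        ennreal (discount M) * (\<integral>\<^sup>+u\<in>live M. value_iter M N u \<partial>trans_law M (y, f y))"
    using f Suc.prems by (auto simp: first_stage_selector_def simp del: value_iter.simps)
  interpret controlled_process M "stationary M f"
    using model stationary_in_policies[OF model sel] by unfold_locales
  have z: "(y, f y) \<in> live_graph M" and ys: "y \<in> states M"
    using sel Suc.prems by (auto simp: selectors_def live_graph_def live_def)
  have "f y \<in> feasible M y" "feasible M y \<subseteq> actions M"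
    using z ys model by (auto simp: live_graph_def is_control_model_def)
  then have fy: "f y \<in> space (action_space M)"
    by (auto simp: action_space_def space_restrict_space)
  define g where "g a = stage_cost M (y, a) + ennreal (discount M) *
        (\<integral>\<^sup>+u. cost_to_go M (stationary M f) k (Suc t) u \<partial>next_state_law M (y, a))" for a
  have [measurable]: "Pair y \<in> action_space M \<rightarrow>\<^sub>M pair_space M"
    using ys unfolding pair_space_def by (intro measurable_Pair1') simp
  have g: "g \<in> borel_measurable (action_space M)" unfolding g_def[abs_def] by measurable
  have step: "cost_to_go M (stationary M f) (Suc k) t y = ennreal (cost M (y, f y)) +
      ennreal (discount M) *
        (\<integral>\<^sup>+u\<in>live M. cost_to_go M (stationary M f) k (Suc t) u \<partial>trans_law M (y, f y))"
    using nn_integral_return[OF fy g] Suc.prems z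
    by (simp add: g_def decision_law_def stationary_def stage_cost_def next_cost_to_go[unfolded stationary_def])
  \<comment> \<open>Passing from \<open>v (N + 1)\<close> down to \<open>v N\<close> costs \<open>c_bar \<gamma>^N w\<close>. The total coefficient \<open>?\<kappa>\<close> is the
    geometric tail from \<open>N\<close> on, and a factor \<open>\<gamma>\<close> turns it into the tail from \<open>N + 1\<close> on.\<close>
  let ?\<kappa> = "c_bar * modulus ^ N + c_bar * modulus ^ Suc N / (1 - modulus)"
  have "cost_to_go M (stationary M f) k (Suc t) u \<le> value_iter M N u + ennreal (?\<kappa> * w u)"
    if u: "u \<in> live M" for u
  proof -
    have "cost_to_go M (stationary M f) k (Suc t) u \<le>
        value_iter M (Suc N) u + ennreal (c_bar * modulus ^ Suc N / (1 - modulus) * w u)"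
      using u by (rule Suc.IH)
    also have "\<dots> \<le> value_iter M N u + ennreal (c_bar * modulus ^ N * w u) +
        ennreal (c_bar * modulus ^ Suc N / (1 - modulus) * w u)"
      using u by (intro add_right_mono value_iter_increment)
    also have "\<dots> = value_iter M N u + ennreal (?\<kappa> * w u)"
      using c_bar modulus w_ge_1[OF u]
      by (simp add: add.assoc ennreal_plus[symmetric] distrib_right del: ennreal_plus)
    finally show ?thesis .
  qed
  then have "cost_to_go M (stationary M f) (Suc k) t y \<le> ennreal (cost M (y, f y)) +
      (ennreal (discount M) * (\<integral>\<^sup>+u\<in>live M. value_iter M N u \<partial>trans_law M (y, f y)) +
       ennreal (?\<kappa> * modulus * w y))"
    unfolding step using c_bar modulus
    by (intro add_left_mono discounted_integral_perturbation z) auto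
  also have "\<dots> = value_iter M (Suc N) y + ennreal (?\<kappa> * modulus * w y)"
    unfolding v by (simp add: add.assoc)
  also have "?\<kappa> * modulus = c_bar * modulus ^ Suc N / (1 - modulus)"
    using modulus by (simp add: field_simps)
  finally show ?case .
qed simp

lemma policy_cost_first_stage_selector_le:
  assumes f: "first_stage_selector M N f" and y: "y \<in> live M"
  shows "policy_cost M (stationary M f) y \<le>
    value_iter M (Suc N) y + ennreal (c_bar * modulus ^ Suc N / (1 - modulus) * w y)"
proof -
  interpret controlled_process M "stationary M f"
    using model f stationary_in_policies[OF model] by unfold_locales (auto simp: first_stage_selector_def)
  have "y \<in> states M" using y by (simp add: live_def)
  then show ?thesis
    unfolding policy_cost_eq_SUP[OF \<open>y \<in> states M\<close>]
    by (intro SUP_least cost_to_go_first_stage_selector_le f y)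
qed

end

section \<open>Performance of the rolling-horizon policy\<close>

theorem theorem7p2:
  fixes M :: "('x::polish_space, 'a::polish_space) control_model"
    and c_bar \<beta> :: real
    and w :: "'x \<Rightarrow> real"
    and N :: nat
    and f :: "'x \<Rightarrow> 'a"
    and x :: 'x
  assumes "is_control_model M"
    and "\<forall>x\<in>states M. compact (feasible M x)"
    and "lsc_on (live_graph M) (cost M)"
    and "\<forall>z\<in>live_graph M. 0 \<le> cost M z"
    and "inf_compact M (cost M)"
    and "strongly_feller M"
    and "0 < c_bar"
    and "1 \<le> \<beta>" and "\<beta> < 1 / discount M"
    and "w \<in> borel_measurable (restrict_space borel (live M))"
    and "\<forall>x\<in>live M. 1 \<le> w x"
    and "\<forall>x\<in>live M. (SUP a\<in>feasible M x. ereal (cost M (x, a))) \<le> ereal (c_bar * w x)"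
    and "\<forall>x\<in>live M. (SUP a\<in>feasible M x. \<integral>\<^sup>+y\<in>live M. ennreal (w y) \<partial>trans_law M (x, a))
                      \<le> ennreal (\<beta> * w x)"
    and "first_stage_selector M N f"
    and "x \<in> live M"
  defines "\<gamma> \<equiv> discount M * \<beta>"
  shows "0 \<le> enn2ereal (policy_cost M (stationary M f) x) - enn2ereal (value_iter M (Suc N) x)
       \<and> enn2ereal (policy_cost M (stationary M f) x) - enn2ereal (value_iter M (Suc N) x)
           \<le> ereal (c_bar * w x * (\<gamma> ^ (N + 1) / (1 - \<gamma>)))
       \<and> enn2ereal (policy_cost M (stationary M f) x) - enn2ereal (optimal_cost M x)
           \<le> ereal (c_bar * w x * (\<gamma> ^ (N + 1) / (1 - \<gamma>)))"
proof -
  interpret weighted_control_model M c_bar \<beta> w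
  proof
    fix y a assume z: "(y, a) \<in> live_graph M"
    then have y: "y \<in> live M" and a: "a \<in> feasible M y" by (simp_all add: live_graph_def)
    have "ereal (cost M (y, a)) \<le> (SUP a\<in>feasible M y. ereal (cost M (y, a)))"
      using a by (rule SUP_upper)
    also have "\<dots> \<le> ereal (c_bar * w y)" using assms(12) y by blast
    finally show "cost M (y, a) \<le> c_bar * w y" by simp
    have "(\<integral>\<^sup>+u\<in>live M. ennreal (w u) \<partial>trans_law M (y, a)) \<le>
        (SUP a\<in>feasible M y. \<integral>\<^sup>+u\<in>live M. ennreal (w u) \<partial>trans_law M (y, a))"
      using a by (rule SUP_upper)
    also have "\<dots> \<le> ennreal (\<beta> * w y)" using assms(13) y by blast
    finally show "(\<integral>\<^sup>+u\<in>live M. ennreal (w u) \<partial>trans_law M (y, a)) \<le> ennreal (\<beta> * w y)" .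
  qed (use assms(1,7-11) in simp_all)
  have \<gamma>_eq: "\<gamma> = modulus" by (simp add: assms(16) modulus_def)
  let ?V = "policy_cost M (stationary M f) x" and ?v = "value_iter M (Suc N) x"
  let ?r = "c_bar * modulus ^ Suc N / (1 - modulus) * w x"
  have v_le: "?v \<le> policy_cost M \<pi> x" if "\<pi> \<in> policies M" for \<pi>
  proof -
    interpret controlled_process M \<pi> using model that by unfold_locales
    show ?thesis using assms(15) by (rule value_iter_le_policy_cost)
  qed
  have lower: "?v \<le> ?V"
    using assms(14) stationary_in_policies[OF model] by (intro v_le) (simp add: first_stage_selector_def)
  have opt: "?v \<le> optimal_cost M x"
    unfolding optimal_cost_def by (intro INF_greatest v_le)
  have upper: "?V \<le> ?v + ennreal ?r"
    using assms(14,15) by (rule policy_cost_first_stage_selector_le)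
  have r: "0 \<le> ?r" using c_bar modulus w_ge_1[OF assms(15)] by auto
  obtain v where v: "?v = ennreal v" "0 \<le> v"
    using value_iter_finite[OF assms(15), of "Suc N"] by (cases ?v rule: ennreal_cases) (auto simp del: value_iter.simps)
  have "?V < \<infinity>" using upper v by (auto intro: le_less_trans)
  then obtain V where V: "?V = ennreal V" "0 \<le> V"
    by (cases ?V rule: ennreal_cases) auto
  have le: "v \<le> V" using lower v V by (simp del: value_iter.simps)
  have "V \<le> v + ?r"
    using upper v V r by (simp add: ennreal_plus[symmetric] del: value_iter.simps ennreal_plus)
  then have gap: "V - v \<le> ?r" by linarith
  have diff: "enn2ereal ?V - enn2ereal ?v = ereal (V - v)" using v V by (simp del: value_iter.simps)
  have "enn2ereal ?V - enn2ereal (optimal_cost M x) \<le> enn2ereal ?V - enn2ereal ?v"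
    using opt by (intro ereal_minus_mono) (simp_all add: less_eq_ennreal.rep_eq[symmetric] del: value_iter.simps)
  also have "\<dots> \<le> ereal ?r" unfolding diff using gap by simp
  finally have opt_gap: "enn2ereal ?V - enn2ereal (optimal_cost M x) \<le> ereal ?r" .
  have r_eq: "c_bar * w x * (modulus ^ (N + 1) / (1 - modulus)) = ?r" by simp
  show ?thesis
    unfolding \<gamma>_eq r_eq diff using le gap opt_gap by simp
qed

end
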